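(* Let $\mu$ be a real number and let $l_\mu:\mathbb{D}\to\mathbb{C}$ be the normalized Lommel function $$l_{\mu}(z)=\mu(\mu+1)z^{-\frac{\mu}{2}+\frac{3}{4}}s_{\mu-\frac{1}{2},\frac{1}{2}}(\sqrt{z})=z\cdot{}_1F_2\left(1;\frac{\mu+2}{2},\frac{\mu+3}{2};-\frac{z}{4}\right)=\sum_{n\geq0}\frac{(-1)^n\,\Gamma\left(\frac{\mu}{2}+1\right)\Gamma\left(\frac{\mu}{2}+\frac{3}{2}\right)z^{n+1}}{4^n\,\Gamma\left(\frac{\mu}{2}+n+1\right)\Gamma\left(\frac{\mu}{2}+n+\frac{3}{2}\right)}.$$ If $\mu\in(-1,1)$ and $\mu\neq0$, then $l_{\mu}$ is starlike in $\mathbb{D}$ and all of its derivatives are close-to-convex in $\mathbb{D}$.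
   Context: $\mathbb{D}=\{z\in\mathbb{C}:|z|<1\}$ is the open unit disk. $s_{\mu,\nu}$ is the Lommel function of the first kind, $s_{\mu,\nu}(z)=\frac{z^{\mu+1}}{(\mu-\nu+1)(\mu+\nu+1)}\,{}_{1}F_{2}\left(1;\frac{\mu-\nu+3}{2},\frac{\mu+\nu+3}{2};-\frac{z^2}{4}\right)$, where ${}_1F_2(a;b,c;x)=\sum_{n\ge0}\frac{(a)_n}{(b)_n(c)_n}\frac{x^n}{n!}$ is the generalized hypergeometric function and $(a)_n=a(a+1)\cdots(a+n-1)$, $(a)_0=1$. "All of its derivatives" means $l_\mu^{(k)}$ for all integers $k\ge1$. The terms are used in the usual sense of geometric function theory, without requiring the derivatives to be normalized: a function analytic in $\mathbb{D}$ and vanishing at $0$ is starlike if it is univalent and its image is starlike with respect to $0$; an analytic function $g$ is close-to-convex in $\mathbb{D}$ if there is a function $\phi$ that is univalent on $\mathbb{D}$ with convex image and satisfies $\mathrm{Re}\,(g'(z)/\phi'(z))>0$ for all $z\in\mathbb{D}$. *)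

theory Defs
  imports "HOL-Analysis.Analysis"
begin

definition hypergeo_1F2 :: "complex \<Rightarrow> complex \<Rightarrow> complex \<Rightarrow> complex \<Rightarrow> complex" where
  "hypergeo_1F2 a b c x = eval_fps (fps_hypergeo [a] [b, c] 1) x"

lemma hypergeo_1F2_series:
  "hypergeo_1F2 a b c x =
     (\<Sum>n. pochhammer a n / (pochhammer b n * pochhammer c n) * (x ^ n / fact n))"
  unfolding hypergeo_1F2_def eval_fps_def by (simp add: field_simps)

definition lommel_s :: "complex \<Rightarrow> complex \<Rightarrow> complex \<Rightarrow> complex" where
  "lommel_s \<mu> \<nu> z =
     z powr (\<mu> + 1) / ((\<mu> - \<nu> + 1) * (\<mu> + \<nu> + 1)) *
     hypergeo_1F2 1 ((\<mu> - \<nu> + 3) / 2) ((\<mu> + \<nu> + 3) / 2) (- (z\<^sup>2 / 4))"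

text \<open>
  Powers and square root are principal branches. The branch factors cancel exactly, also on the
  negative real axis, and \<open>0 powr w = 0\<close> gives the right value at the origin; see
  \<open>lommel_l_eq_hypergeo\<close> and \<open>lommel_l_sums\<close> below.
\<close>

definition lommel_l :: "real \<Rightarrow> complex \<Rightarrow> complex" where
  "lommel_l \<mu> z =
     of_real (\<mu> * (\<mu> + 1)) * z powr of_real (- \<mu> / 2 + 3 / 4) *
     lommel_s (of_real (\<mu> - 1 / 2)) (1 / 2) (csqrt z)"

lemma lommel_l_eq_hypergeo:
  assumes "\<mu> \<noteq> 0" "\<mu> \<noteq> -1"
  shows "lommel_l \<mu> z =
           z * hypergeo_1F2 1 ((of_real \<mu> + 2) / 2) ((of_real \<mu> + 3) / 2) (- z / 4)"
proof (cases "z = 0")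
  case True
  then show ?thesis by (simp add: lommel_l_def)
next
  case False
  let ?m = "of_real \<mu> :: complex"
  have "Ln (exp (Ln z / 2)) = Ln z / 2"
    using Im_Ln_le_pi[OF False] mpi_less_Im_Ln[OF False] pi_gt_zero
    by (intro Ln_exp) (auto simp del: pi_gt_zero)
  then have Lsq: "Ln (csqrt z) = Ln z / 2"
    using False by (simp add: csqrt_exp_Ln)
  have "csqrt z powr (?m + 1 / 2) = exp ((?m + 1 / 2) * (Ln z / 2))"
    using False by (simp only: powr_def Lsq csqrt_eq_0 if_False)
  moreover have "z powr (- ?m / 2 + 3 / 4) = exp ((- ?m / 2 + 3 / 4) * Ln z)"
    using False by (simp add: powr_def)
  ultimately have "z powr (- ?m / 2 + 3 / 4) * csqrt z powr (?m + 1 / 2) =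
      exp ((- ?m / 2 + 3 / 4) * Ln z + (?m + 1 / 2) * (Ln z / 2))"
    by (simp add: exp_add)
  also have "(- ?m / 2 + 3 / 4) * Ln z + (?m + 1 / 2) * (Ln z / 2) = Ln z"
    by (simp add: field_simps)
  finally have pw: "z powr (- ?m / 2 + 3 / 4) * csqrt z powr (?m + 1 / 2) = z"
    using False by simp
  have nz: "?m * (?m + 1) \<noteq> 0"
    using assms by (metis add_eq_0_iff2 mult_eq_0_iff of_real_1 of_real_eq_0_iff of_real_eq_iff of_real_minus)
  have e: "?m - 1 / 2 + 1 = ?m + 1 / 2" "?m - 1 / 2 - 1 / 2 + 1 = ?m"
    "?m - 1 / 2 + 1 / 2 + 1 = ?m + 1"
    "?m - 1 / 2 - 1 / 2 + 3 = ?m + 2" "?m - 1 / 2 + 1 / 2 + 3 = ?m + 3"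
    by simp_all
  have "lommel_l \<mu> z = ?m * (?m + 1) * z powr (- ?m / 2 + 3 / 4) *
      (csqrt z powr (?m + 1 / 2) / (?m * (?m + 1)) *
       hypergeo_1F2 1 ((?m + 2) / 2) ((?m + 3) / 2) (- (z / 4)))"
    unfolding lommel_l_def lommel_s_def by (simp add: e add.commute)
  also have "\<dots> = (z powr (- ?m / 2 + 3 / 4) * csqrt z powr (?m + 1 / 2)) *
       hypergeo_1F2 1 ((?m + 2) / 2) ((?m + 3) / 2) (- (z / 4))"
    using nz by (simp add: field_simps)
  finally show ?thesis
    by (simp only: pw minus_divide_left)
qed

lemma lommel_l_sums:
  assumes "-1 < \<mu>" "\<mu> \<noteq> 0"
  shows "(\<lambda>n. (-1) ^ n * of_real (Gamma (\<mu> / 2 + 1) * Gamma (\<mu> / 2 + 3 / 2)) * z ^ (n + 1) /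
           (4 ^ n * of_real (Gamma (\<mu> / 2 + real n + 1) * Gamma (\<mu> / 2 + real n + 3 / 2))))
         sums lommel_l \<mu> z"
proof -
  let ?b = "\<mu> / 2 + 1" and ?c = "\<mu> / 2 + 3 / 2" and ?x = "- z / 4"
  define f where "f = (\<lambda>n. ?x ^ n / of_real (pochhammer ?b n * pochhammer ?c n))"
  have pos: "?b > 0" "?c > 0" using assms by auto
  have bc: "(of_real \<mu> + 2) / 2 = (of_real ?b :: complex)"
    "(of_real \<mu> + 3) / 2 = (of_real ?c :: complex)"
    by (simp_all add: field_simps)
  obtain N where N: "real N > 2 * norm ?x + 1" using reals_Archimedean2 by blast
  have "summable f"
  proof (rule summable_ratio_test)
    fix n assume n: "n \<ge> N"
    have "real n * 1 \<le> (?b + n) * (?c + n)"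
      using pos n N assms by (intro mult_mono) (auto intro: order.trans[of 1 "real N"])
    moreover have "2 * norm ?x < real n" using N n by linarith
    ultimately have le: "2 * norm ?x \<le> (?b + n) * (?c + n)" by linarith
    have p: "(?b + n) * (?c + n) > 0" using pos by (intro mult_pos_pos) auto
    have "f (Suc n) = f n * (?x / of_real ((?b + n) * (?c + n)))"
      by (simp add: f_def pochhammer_Suc mult_ac)
    then have "norm (f (Suc n)) = norm (f n) * (norm ?x / ((?b + n) * (?c + n)))"
      using p by (simp only: norm_mult norm_divide norm_of_real abs_of_pos)
    also have "\<dots> \<le> norm (f n) * (1 / 2)"
      using le p by (intro mult_left_mono) (auto simp: divide_le_eq)
    finally show "norm (f (Suc n)) \<le> 1 / 2 * norm (f n)" by simp
  qed simp
  moreover have "suminf f = hypergeo_1F2 1 (of_real ?b) (of_real ?c) ?x"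
    unfolding hypergeo_1F2_series f_def
    by (intro suminf_cong) (simp add: pochhammer_fact[symmetric] pochhammer_of_real[symmetric])
  ultimately have "f sums hypergeo_1F2 1 (of_real ?b) (of_real ?c) ?x"
    by (metis summable_sums)
  then have *: "(\<lambda>n. z * f n) sums lommel_l \<mu> z"
    using assms by (subst lommel_l_eq_hypergeo) (auto simp only: bc intro: sums_mult)
  have G: "pochhammer ?b n = Gamma (?b + n) / Gamma ?b"
    "pochhammer ?c n = Gamma (?c + n) / Gamma ?c" for n
    using pos by (intro pochhammer_Gamma; auto elim!: nonpos_Ints_cases)+
  have x: "(- z / 4) ^ n = (-1) ^ n * z ^ n / 4 ^ n" for n
    by (simp only: power_divide power_minus[of z])
  have "z * f n =
      (-1) ^ n * of_real (Gamma ?b * Gamma ?c) * z ^ (n + 1) /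
      (4 ^ n * of_real (Gamma (\<mu> / 2 + real n + 1) * Gamma (\<mu> / 2 + real n + 3 / 2)))" for n
  proof -
    have "f n = (-1) ^ n * z ^ n / 4 ^ n /
        of_real ((Gamma (?b + n) / Gamma ?b) * (Gamma (?c + n) / Gamma ?c))"
      by (simp only: f_def G x)
    moreover have "?b + n = \<mu> / 2 + real n + 1" "?c + n = \<mu> / 2 + real n + 3 / 2" by simp_all
    ultimately show ?thesis by (simp only:) simp
  qed
  with * show ?thesis by simp
qed

definition univalent_on_disk :: "(complex \<Rightarrow> complex) \<Rightarrow> bool" where
  "univalent_on_disk f \<longleftrightarrow> f holomorphic_on ball 0 1 \<and> inj_on f (ball 0 1)"

text \<open>The library's \<^const>\<open>starlike\<close> leaves the centre of the set unspecified.\<close>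

definition starlike_wrt :: "complex \<Rightarrow> complex set \<Rightarrow> bool" where
  "starlike_wrt a S \<longleftrightarrow> a \<in> S \<and> (\<forall>w\<in>S. closed_segment a w \<subseteq> S)"

definition starlike_fun :: "(complex \<Rightarrow> complex) \<Rightarrow> bool" where
  "starlike_fun f \<longleftrightarrow>
     f 0 = 0 \<and> univalent_on_disk f \<and> starlike_wrt 0 (f ` ball 0 1)"

definition close_to_convex_fun :: "(complex \<Rightarrow> complex) \<Rightarrow> bool" where
  "close_to_convex_fun g \<longleftrightarrow>
     g holomorphic_on ball 0 1 \<and>
     (\<exists>\<phi>. univalent_on_disk \<phi> \<and> convex (\<phi> ` ball 0 1) \<and>
          (\<forall>z\<in>ball 0 1. Re (deriv g z / deriv \<phi> z) > 0))"

end

theory Submission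
  imports Defs "HOL-Complex_Analysis.Conformal_Mappings"
begin

text \<open>
  The normalized Lommel function is \<open>l z = z * g z\<close> with
  \<open>g z = (\<Sum>n. (-1)^n z^n / pochhammer (\<mu> + 2) (2 * n))\<close>, because the duplication formula merges
  the two Pochhammer symbols of the hypergeometric series with the factor \<open>4 ^ n\<close>. Consecutive
  coefficients of \<open>g\<close> have the quotient \<open>- 1 / ((\<mu> + 2 n + 2) (\<mu> + 2 n + 3))\<close>, and for \<open>\<mu> > -1\<close>
  its modulus is below \<open>1 / ((2 n + 1) (2 n + 2))\<close>, that is \<open>1/2\<close>, \<open>1/12\<close>, \<open>1/30\<close> and
  so on. This decay gives both conclusions.

  Starlikeness. Since \<open>z l' / l = 1 + z g' / g\<close>, it is enough that \<open>|z g'| < |g|\<close> in the disk. As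
  \<open>\<mu> \<longrightarrow> -1\<close> the series tends to \<open>z cos (sqrt z)\<close>, for which the coefficient test
  \<open>(\<Sum>n\<ge>2. n |a n|) \<le> 1\<close> fails; so the
  terms of \<open>g\<close> up to \<open>z^2\<close> and of \<open>g'\<close> up to \<open>z\<close> are kept exactly and only the tails are estimated
  (\<open>lommel_fps_deriv_bounds\<close>). The same estimate gives \<open>Re l' > 0\<close>, hence univalence
  by the Noshiro-Warschawski criterion (\<open>inj_on_if_Re_deriv_pos\<close>). Positivity of
  \<open>Re (z l' / l)\<close> then makes the image starlike (\<open>starlike_wrt_image_ball\<close>).

  Close-to-convexity. Differentiating \<open>k + 1\<close> times multiplies the coefficient quotients by rational
  factors; for \<open>k \<ge> 1\<close> they are still at most \<open>1/4\<close> in modulus. So the \<open>k\<close>-th derivative of \<open>l\<close> has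
  a derivative that is dominated by its constant term, and it is close-to-convex with respect to a
  linear map (\<open>eval_fps_close_to_convex\<close>).
\<close>

unbundle no vec_syntax
unbundle fps_syntax

section \<open>Two geometric criteria\<close>

text \<open>
  If \<open>f a = f b\<close>, the mean value theorem applied to the real part of \<open>f / (b - a)\<close> on the segment
  from \<open>a\<close> to \<open>b\<close> yields a point where \<open>Re f'\<close> vanishes.
\<close>

lemma inj_on_if_Re_deriv_pos:
  fixes f :: "complex \<Rightarrow> complex"
  assumes holo: "f holomorphic_on S" and S: "open S" "convex S"
    and pos: "\<And>z. z \<in> S \<Longrightarrow> 0 < Re (deriv f z)"
  shows "inj_on f S"
proof (rule inj_onI, rule ccontr)
  fix a b assume ab: "a \<in> S" "b \<in> S" "f a = f b" "a \<noteq> b"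
  have "((\<lambda>w. f w / (b - a)) has_field_derivative deriv f u / (b - a)) (at u)"
    if "u \<in> closed_segment a b" for u
  proof -
    have "u \<in> S" using closed_segment_subset[of a S b] ab S that by blast
    then show ?thesis
      using holomorphic_derivI[OF holo S(1), of u] by (intro DERIV_cdivide) auto
  qed
  then obtain u where "u \<in> closed_segment a b"
    and "Re (f b / (b - a)) - Re (f a / (b - a)) = Re (deriv f u / (b - a) * (b - a))"
    using complex_mvt_line[of a b "\<lambda>w. f w / (b - a)" "\<lambda>u. deriv f u / (b - a)"] by blast
  moreover from this have "u \<in> S" using closed_segment_subset[of a S b] ab S by blast
  ultimately show False using pos[of u] ab by simp
qed

text \<open>
  Along the preimage \<open>h (s * w)\<close> of a ray, the derivative of \<open>|h|^2\<close> in \<open>s\<close> is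
  \<open>2 |h|^2 / s * Re (f / (h f'))\<close>, which is positive: going towards 0 on the ray, the preimage moves
  inwards. Hence it cannot leave the closed disk of radius \<open>|z0|\<close>, and no part of
  the segment from \<open>f z0\<close> to 0 can be missing from the image of that compact disk.
\<close>

lemma starlike_wrt_image_ball:
  assumes holo: "f holomorphic_on ball 0 1" and inj: "inj_on f (ball 0 1)" and f0: "f 0 = 0"
    and star: "\<And>z. z \<in> ball 0 1 \<Longrightarrow> z \<noteq> 0 \<Longrightarrow> 0 < Re (z * deriv f z / f z)"
  shows "starlike_wrt 0 (f ` ball 0 1)"
proof -
  let ?D = "ball (0::complex) 1"
  obtain h where holh: "h holomorphic_on f ` ?D"
    and dh: "\<And>z. z \<in> ?D \<Longrightarrow> deriv f z * deriv h (f z) = 1"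
    and hf: "\<And>z. z \<in> ?D \<Longrightarrow> h (f z) = z"
    using holomorphic_has_inverse[OF holo open_ball inj] by blast
  have opn: "open (f ` ?D)" by (rule open_mapping_thm3[OF holo open_ball inj])
  have "closed_segment 0 (f z0) \<subseteq> f ` ?D" if z0: "z0 \<in> ?D" for z0
  proof -
    define A where "A = {t \<in> {0..1}. of_real t * f z0 \<in> f ` cball 0 (norm z0)}"
    have sub: "cball 0 (norm z0) \<subseteq> ?D" using z0 by auto
    have "compact (f ` cball 0 (norm z0))"
      using holo sub by (intro compact_continuous_image compact_cball
          holomorphic_on_imp_continuous_on) (rule holomorphic_on_subset)
    then have "closed (f ` cball 0 (norm z0))" by (rule compact_imp_closed)
    then have clA: "closed A"
      unfolding A_def
      by (intro continuous_closed_preimage[unfolded vimage_def Int_def, simplified]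
          continuous_intros) auto
    have "t \<in> A" if t: "t \<in> {0..1}" for t
    proof (rule ccontr)
      assume tA: "t \<notin> A"
      \<comment> \<open>\<open>b\<close> is the upper end of the gap in \<open>A\<close> around \<open>t\<close>.\<close>
      define B where "B = A \<inter> {t..1}"
      have "1 \<in> B" using t by (auto simp: B_def A_def)
      have "compact B" unfolding B_def using clA by (intro closed_Int_compact) auto
      then obtain b where bB: "b \<in> B" and least: "\<And>s. s \<in> B \<Longrightarrow> b \<le> s"
        using \<open>1 \<in> B\<close> compact_attains_inf[of B] by blast
      have tb: "t < b" and b1: "b \<le> 1" using bB tA by (auto simp: B_def less_le)
      obtain z1 where z1: "norm z1 \<le> norm z0" and bz: "of_real b * f z0 = f z1"
        using bB by (auto simp: B_def A_def)
      have z1D: "z1 \<in> ?D" using z1 z0 by auto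
      \<comment> \<open>Preimages of points in the gap lie outside the disk of radius \<open>|z0|\<close>; this will be
        contradicted just below \<open>b\<close>, where they have smaller modulus than \<open>z1\<close>.\<close>
      have gap: "norm z0 < norm (h (of_real s * f z0))"
        if s: "t < s" "s < b" "of_real s * f z0 \<in> f ` ?D" for s
      proof (rule ccontr)
        assume "\<not> ?thesis"
        moreover obtain w where "w \<in> ?D" "of_real s * f z0 = f w" using s by auto
        ultimately have "s \<in> B" using hf s tb t b1 by (auto simp: B_def A_def)
        then show False using least s by force
      qed
      have "open ((\<lambda>s. of_real s * f z0) -` f ` ?D)"
        by (intro open_vimage[OF opn] continuous_intros)
      moreover have "b \<in> (\<lambda>s. of_real s * f z0) -` f ` ?D" using bz z1D by auto
      ultimately obtain e where e: "0 < e"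
        and eb: "\<And>s. \<bar>s - b\<bar> < e \<Longrightarrow> of_real s * f z0 \<in> f ` ?D"
        unfolding open_dist dist_real_def by (meson vimage_eq)
      define u where "u = (\<lambda>s. h (of_real s * f z0))"
      have ub: "u b = z1" using bz hf[OF z1D] by (simp add: u_def)
      have fz0: "f z0 \<noteq> 0"
      proof
        assume "f z0 = 0"
        then have "t \<in> A" using t f0 by (force simp: A_def)
        then show False using tA by simp
      qed
      then have fz1: "f z1 \<noteq> 0" using bz tb t by auto
      then have z1n: "z1 \<noteq> 0" using f0 by auto
      have "(h has_field_derivative deriv h (f z1)) (at (of_real b * f z0))"
        using holomorphic_derivI[OF holh opn, of "f z1"] z1D bz by auto
      moreover have "((\<lambda>s. of_real s * f z0) has_vector_derivative f z0) (at b)"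
        by (auto intro!: derivative_eq_intros)
      ultimately have "(u has_vector_derivative f z0 * deriv h (f z1)) (at b)"
        unfolding u_def using field_vector_diff_chain_at[of "\<lambda>s. of_real s * f z0" "f z0" b h]
        by (simp add: o_def)
      then have "((\<lambda>s. (norm (u s))\<^sup>2) has_real_derivative 2 * (z1 \<bullet> (f z0 * deriv h (f z1)))) (at b)"
        unfolding power2_norm_eq_inner has_real_derivative_iff_has_vector_derivative
        using bounded_bilinear.has_vector_derivative[OF bounded_bilinear_inner, of u _ b UNIV u]
        by (fastforce simp: ub inner_commute)
      moreover have "0 < 2 * (z1 \<bullet> (f z0 * deriv h (f z1)))"
      proof -
        define p where "p = z1 * deriv f z1 / f z1"
        have p: "0 < Re p" unfolding p_def by (rule star[OF z1D z1n])
        have b0: "0 < b" using tb t by simp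
        have dh1: "deriv h (f z1) = 1 / deriv f z1"
          using dh[OF z1D] by (metis eq_divide_imp mult.commute mult_zero_left zero_neq_one)
        have fz0b: "f z0 = f z1 / of_real b" using bz b0 by (simp add: field_simps)
        have "f z0 * deriv h (f z1) = z1 * (of_real (1 / b) * inverse p)"
          unfolding dh1 unfolding fz0b p_def using fz1 z1n b0 by (simp add: field_simps)
        moreover have "z1 \<bullet> (z1 * q) = (norm z1)\<^sup>2 * Re q" for q
          unfolding cmod_power2 by (simp add: inner_complex_def power2_eq_square algebra_simps)
        moreover have "Re (of_real (1 / b) * inverse p) = 1 / b * (Re p / ((Re p)\<^sup>2 + (Im p)\<^sup>2))"
          by simp
        moreover have "0 < (norm z1)\<^sup>2 * (1 / b * (Re p / ((Re p)\<^sup>2 + (Im p)\<^sup>2)))"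
          using z1n b0 p by (intro mult_pos_pos divide_pos_pos add_pos_nonneg) auto
        ultimately show ?thesis by (simp only: zero_less_mult_iff) simp
      qed
      ultimately obtain d where d: "0 < d"
        and dec: "\<And>k. 0 < k \<Longrightarrow> k < d \<Longrightarrow> (norm (u (b - k)))\<^sup>2 < (norm (u b))\<^sup>2"
        using DERIV_pos_inc_left by blast
      obtain k where k: "0 < k" "k < d" "k < e" "k < b - t"
        using field_lbound_gt_zero[of "min d e" "b - t"] d e tb by auto
      have "norm (u (b - k)) < norm z1" using dec[OF k(1,2)] ub by (simp add: power2_less_imp_less)
      moreover have "norm z0 < norm (u (b - k))" unfolding u_def using k by (intro gap eb) auto
      ultimately show False using z1 by simp
    qed
    then show ?thesis
      using sub by (fastforce simp: A_def closed_segment_def scaleR_conv_of_real)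
  qed
  moreover have "0 \<in> f ` ?D" using f0 by (metis centre_in_ball image_eqI zero_less_one)
  ultimately show ?thesis by (auto simp: starlike_wrt_def)
qed

section \<open>Power series with rapidly decreasing coefficients\<close>

lemma eval_fps_tail_bound:
  fixes F :: "complex fps"
  assumes conv: "1 < fps_conv_radius F" and z: "norm z \<le> 1" and q: "0 \<le> q" "q < 1"
    and ratio: "\<And>n. n \<ge> N \<Longrightarrow> norm (F $ Suc n) \<le> q * norm (F $ n)"
  shows "norm (eval_fps F z - (\<Sum>n<N. F $ n * z ^ n)) \<le> norm (F $ N) / (1 - q)"
proof -
  have "ereal (norm z) < fps_conv_radius F"
    using conv z by (metis ereal_less_eq(3) le_less_trans one_ereal_def)
  then have summ: "summable (\<lambda>n. F $ n * z ^ n)" by (rule summable_fps)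
  have geo: "norm (F $ (n + N)) \<le> norm (F $ N) * q ^ n" for n
  proof (induction n)
    case (Suc n)
    have "norm (F $ (Suc n + N)) \<le> q * norm (F $ (n + N))" using ratio[of "n + N"] by simp
    also have "\<dots> \<le> q * (norm (F $ N) * q ^ n)" using Suc q by (intro mult_left_mono)
    finally show ?case by (simp add: mult_ac)
  qed simp
  have "norm (F $ (n + N) * z ^ (n + N)) \<le> norm (F $ N) * q ^ n" for n
    using geo[of n] z mult_mono[OF geo[of n] power_le_one[of "norm z" "n + N"]] q
    by (simp add: norm_mult norm_power)
  moreover have "(\<lambda>n. norm (F $ N) * q ^ n) sums (norm (F $ N) * (1 / (1 - q)))"
    using q by (intro sums_mult geometric_sums) auto
  ultimately have "norm (\<Sum>n. F $ (n + N) * z ^ (n + N)) \<le> norm (F $ N) * (1 / (1 - q))"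
    by (metis (no_types, lifting) norm_suminf_le sums_summable sums_unique)
  then show ?thesis
    using suminf_minus_initial_segment[OF summ, of N] by (simp add: eval_fps_def)
qed

lemma fps_nth_deriv_funpow:
  fixes F :: "'a :: field_char_0 fps"
  shows "(fps_deriv ^^ k) F $ n = fact (n + k) / fact n * F $ (n + k)"
proof (induction k arbitrary: n)
  case (Suc k)
  have "fact (Suc n) = (of_nat (Suc n) * fact n :: 'a)" by simp
  then show ?case using Suc[of "Suc n"] by (simp del: of_nat_Suc fact_Suc)
qed simp

lemma fps_conv_radius_deriv_funpow_inf:
  fixes F :: "complex fps"
  assumes "fps_conv_radius F = \<infinity>"
  shows "fps_conv_radius ((fps_deriv ^^ k) F) = \<infinity>"
proof (induction k)
  case (Suc k)
  then show ?case using fps_conv_radius_deriv[of "(fps_deriv ^^ k) F"] by simp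
qed (use assms in simp)

lemma deriv_funpow_eval_fps:
  fixes F :: "complex fps"
  assumes "fps_conv_radius F = \<infinity>"
  shows "(deriv ^^ k) (eval_fps F) = eval_fps ((fps_deriv ^^ k) F)"
proof (induction k)
  case (Suc k)
  show ?case
    by (rule ext) (simp add: Suc eval_fps_deriv fps_conv_radius_deriv_funpow_inf assms)
qed simp

lemma eval_fps_X_mult:
  fixes F :: "complex fps"
  assumes "fps_conv_radius F = \<infinity>"
  shows "eval_fps (fps_X * F) = (\<lambda>z. z * eval_fps F z)"
  by (rule ext) (simp add: eval_fps_mult assms)

text \<open>
  With \<open>q < 1/2\<close> the geometric tail of the derivative has modulus at most
  \<open>q / (1 - q) < 1\<close> times that of the constant term, so \<open>f' / f' 0\<close> stays in the disk of radius 1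
  around 1. The linear map \<open>\<phi> z = f' 0 * z\<close>, whose image is a disk, is then a witness.
\<close>

lemma eval_fps_close_to_convex:
  assumes conv: "fps_conv_radius F = \<infinity>" and nz: "F $ 1 \<noteq> 0" and q: "0 \<le> q" "q < 1 / 2"
    and ratio: "\<And>n. norm (fps_deriv F $ Suc n) \<le> q * norm (fps_deriv F $ n)"
  shows "close_to_convex_fun (eval_fps F)"
  unfolding close_to_convex_fun_def
proof (intro conjI exI ballI)
  let ?a = "F $ 1" \<comment> \<open>the value of the derivative at 0\<close>
  let ?\<phi> = "\<lambda>z. ?a * z"
  show "eval_fps F holomorphic_on ball 0 1"
    by (intro holomorphic_intros) (simp add: conv)
  show "univalent_on_disk ?\<phi>"
    using nz by (auto simp: univalent_on_disk_def inj_on_def intro!: holomorphic_intros)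
  show "convex (?\<phi> ` ball 0 1)"
    by (intro convex_linear_image convex_ball) (simp add: bounded_linear.linear bounded_linear_mult_right)
  fix z :: complex assume z: "z \<in> ball 0 1"
  have conv': "fps_conv_radius (fps_deriv F) = \<infinity>"
    using fps_conv_radius_deriv[of F] conv by simp
  have d: "deriv (eval_fps F) z = eval_fps (fps_deriv F) z"
    by (simp add: eval_fps_deriv conv)
  have d2: "deriv ?\<phi> z = ?a" by (simp)
  have "norm (eval_fps (fps_deriv F) z - ?a) \<le> q * norm ?a / (1 - q)"
  proof -
    have "norm (eval_fps (fps_deriv F) z - ?a) \<le> norm (fps_deriv F $ 1) / (1 - q)"
      using eval_fps_tail_bound[of "fps_deriv F" z q 1] z q ratio conv' by simp
    also have "\<dots> \<le> q * norm ?a / (1 - q)"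
      using ratio[of 0] q by (intro divide_right_mono) auto
    finally show ?thesis .
  qed
  also have "\<dots> < norm ?a" using q nz by (simp add: field_simps)
  finally have "norm ((eval_fps (fps_deriv F) z - ?a) / ?a) < 1"
    using nz by (simp add: norm_divide)
  then have "\<bar>Re (eval_fps (fps_deriv F) z / ?a - 1)\<bar> < 1"
    using abs_Re_le_cmod[of "eval_fps (fps_deriv F) z / ?a - 1"] nz
    by (simp add: diff_divide_distrib)
  then show "0 < Re (deriv (eval_fps F) z / deriv ?\<phi> z)"
    by (simp add: d d2 del: deriv_cmult_right)
qed

section \<open>The Lommel series\<close>

definition lommel_fps :: "real \<Rightarrow> complex fps" where
  "lommel_fps \<mu> = Abs_fps (\<lambda>n. of_real ((-1) ^ n / pochhammer (\<mu> + 2) (2 * n)))"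

lemma lommel_fps_0 [simp]: "lommel_fps \<mu> $ 0 = 1"
  by (simp add: lommel_fps_def)

lemma lommel_fps_Suc:
  "lommel_fps \<mu> $ Suc n =
     - lommel_fps \<mu> $ n / of_real ((\<mu> + 2 * real n + 2) * (\<mu> + 2 * real n + 3))"
  by (simp add: lommel_fps_def pochhammer_Suc mult_ac add_ac)

lemma lommel_fps_nonzero: "-1 < \<mu> \<Longrightarrow> lommel_fps \<mu> $ n \<noteq> 0"
  by (auto simp: lommel_fps_def pochhammer_eq_0_iff)

text \<open>
  The duplication formula turns the two Gamma quotients and the power of 4 into the single symbol
  \<open>pochhammer (\<mu> + 2) (2 * n)\<close>.
\<close>

lemma lommel_l_sums_fps:
  assumes "-1 < \<mu>" "\<mu> \<noteq> 0"
  shows "(\<lambda>n. lommel_fps \<mu> $ n * z ^ (n + 1)) sums lommel_l \<mu> z"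
proof -
  have "(-1) ^ n * of_real (Gamma (\<mu> / 2 + 1) * Gamma (\<mu> / 2 + 3 / 2)) * z ^ (n + 1) /
      (4 ^ n * of_real (Gamma (\<mu> / 2 + real n + 1) * Gamma (\<mu> / 2 + real n + 3 / 2)))
    = lommel_fps \<mu> $ n * z ^ (n + 1)" for n
  proof -
    have "\<mu> / 2 + 1 \<notin> \<int>\<^sub>\<le>\<^sub>0" "\<mu> / 2 + 3 / 2 \<notin> \<int>\<^sub>\<le>\<^sub>0"
      using assms by (auto elim!: nonpos_Ints_cases)
    then have "pochhammer (\<mu> / 2 + 1) n = Gamma (\<mu> / 2 + 1 + n) / Gamma (\<mu> / 2 + 1)"
      "pochhammer (\<mu> / 2 + 3 / 2) n = Gamma (\<mu> / 2 + 3 / 2 + n) / Gamma (\<mu> / 2 + 3 / 2)"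
      by (simp_all add: pochhammer_Gamma)
    moreover have "pochhammer (\<mu> + 2) (2 * n) =
        4 ^ n * pochhammer (\<mu> / 2 + 1) n * pochhammer (\<mu> / 2 + 3 / 2) n"
    proof -
      have "2 * (\<mu> / 2 + 1) = \<mu> + 2" "\<mu> / 2 + 1 + 1 / 2 = \<mu> / 2 + 3 / 2" by simp_all
      moreover have "of_nat (2 ^ (2 * n)) = (4 ^ n :: real)" by (simp add: power_mult)
      ultimately show ?thesis using pochhammer_double[of "\<mu> / 2 + 1" n] by (simp only:)
    qed
    ultimately show ?thesis by (simp add: lommel_fps_def add_ac mult_ac)
  qed
  with lommel_l_sums[OF assms, of z] show ?thesis by (simp only:)
qed

lemma fps_conv_radius_lommel:
  assumes "-1 < \<mu>" "\<mu> \<noteq> 0"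
  shows "fps_conv_radius (lommel_fps \<mu>) = \<infinity>"
  unfolding fps_conv_radius_def
proof (rule conv_radius_inftyI'')
  fix z :: complex
  show "summable (\<lambda>n. lommel_fps \<mu> $ n * z ^ n)"
  proof (cases "z = 0")
    case False
    have "summable (\<lambda>n. inverse z * (lommel_fps \<mu> $ n * z ^ (n + 1)))"
      using lommel_l_sums_fps[OF assms, of z] by (intro summable_mult) (rule sums_summable)
    moreover have "inverse z * (lommel_fps \<mu> $ n * z ^ (n + 1)) = lommel_fps \<mu> $ n * z ^ n" for n
      using False by simp
    ultimately show ?thesis by (simp only:)
  qed simp
qed

lemma lommel_l_eq_eval_fps:
  assumes "-1 < \<mu>" "\<mu> \<noteq> 0"
  shows "lommel_l \<mu> z = z * eval_fps (lommel_fps \<mu>) z"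
proof -
  have "(\<lambda>n. lommel_fps \<mu> $ n * z ^ n) sums eval_fps (lommel_fps \<mu>) z"
    using fps_conv_radius_lommel[OF assms] by (simp add: eval_fps_def summable_fps summable_sums)
  then have "(\<lambda>n. z * (lommel_fps \<mu> $ n * z ^ n)) sums (z * eval_fps (lommel_fps \<mu>) z)"
    by (rule sums_mult)
  with lommel_l_sums_fps[OF assms, of z] show ?thesis
    by (simp add: mult_ac sums_unique2)
qed

text \<open>
  Write \<open>g = 1 - c z + c \<kappa> z^2 + \<dots>\<close>, so that \<open>c < 1/2\<close> and \<open>\<kappa> < 1/12\<close>, and let \<open>x = Re z\<close>. The
  errors of truncating \<open>g\<close> to \<open>A\<close> and \<open>g'\<close> to \<open>B\<close> are small multiples of \<open>c * \<kappa>\<close>. Bounding the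
  constant term 1 from below by \<open>2 * c\<close>, every term of either inequality has the factor \<open>c\<close>, and what
  remains is linear in \<open>1 - x\<close> up to a correction by \<open>\<kappa>\<close> times a quadratic polynomial in \<open>x\<close>. Near
  \<open>x = 1\<close>, where the linear part degenerates, the correction has the favourable sign; away from it,
  the linear part outweighs the correction because of \<open>\<kappa> < 1/12\<close>.
\<close>

lemma lommel_fps_deriv_bounds:
  assumes "-1 < \<mu>" "\<mu> \<noteq> 0" and z: "norm z < 1"
  defines "g \<equiv> eval_fps (lommel_fps \<mu>)" and "g' \<equiv> eval_fps (fps_deriv (lommel_fps \<mu>))"
  shows "norm (z * g' z) < norm (g z)" and "0 < Re (g z + z * g' z)"
proof -
  let ?G = "lommel_fps \<mu>"
  define x where "x = Re z"
  define c where "c = 1 / ((\<mu> + 2) * (\<mu> + 3))"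
  define \<kappa> where "\<kappa> = 1 / ((\<mu> + 4) * (\<mu> + 5))"
  define A where "A = 1 - of_real c * z + of_real (c * \<kappa>) * z\<^sup>2"
  define B where "B = of_real (- c) + of_real (2 * c * \<kappa>) * z"

  have prod: "real i * real j < (\<mu> + real (Suc i)) * (\<mu> + real (Suc j))" if "0 < j" for i j
    using assms(1) that by (intro mult_strict_mono) auto
  have c: "0 < c" "c < 1 / 2" and \<kappa>: "0 < \<kappa>" "\<kappa> < 1 / 12"
    using assms(1) prod[of 2 1] prod[of 4 3] by (auto simp: c_def \<kappa>_def field_simps)
  have x: "-1 < x" "x < 1"
    using abs_Re_le_cmod[of z] z by (auto simp: x_def)
  have conv: "fps_conv_radius ?G = \<infinity>" by (rule fps_conv_radius_lommel[OF assms(1,2)])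
  have conv': "fps_conv_radius (fps_deriv ?G) = \<infinity>"
    using fps_conv_radius_deriv[of ?G] conv by simp

  \<comment> \<open>Coefficient quotients are largest in the limit \<open>\<mu> \<longrightarrow> -1\<close>.\<close>
  have step: "norm (?G $ Suc n) * ((2 * real n + 1) * (2 * real n + 2)) \<le> norm (?G $ n)" for n
  proof -
    let ?P = "(\<mu> + 2 * real n + 2) * (\<mu> + 2 * real n + 3)"
    have le: "(2 * real n + 1) * (2 * real n + 2) \<le> ?P"
      using assms(1) by (intro mult_mono) auto
    moreover have "0 < (2 * real n + 1) * (2 * real n + 2)" by simp
    ultimately have "0 < ?P" by linarith
    then have "norm (?G $ n) = norm (?G $ Suc n) * ?P"
      by (simp only: lommel_fps_Suc norm_divide norm_minus_cancel norm_of_real abs_of_pos)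
         auto
    then show ?thesis using mult_left_mono[OF le, of "norm (?G $ Suc n)"] by simp
  qed
  have G1: "?G $ 1 = of_real (- c)" using lommel_fps_Suc[of \<mu> 0] by (simp add: c_def)
  have G2: "?G $ 2 = of_real (c * \<kappa>)"
    using lommel_fps_Suc[of \<mu> 1] G1 by (simp add: \<kappa>_def add_ac numeral_2_eq_2[symmetric])
  have G3: "norm (?G $ 3) \<le> c * \<kappa> / 30"
    using step[of 2] G2 c \<kappa> by (simp add: norm_mult)

  have "norm (g z - A) \<le> norm (?G $ 3) / (1 - 1 / 6)"
  proof -
    have "norm (?G $ Suc n) \<le> 1 / 6 * norm (?G $ n)" if "n \<ge> 3" for n
    proof -
      have "2 * 3 \<le> (2 * real n + 1) * (2 * real n + 2)" using that by (intro mult_mono) auto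
      then have "norm (?G $ Suc n) * 6 \<le> norm (?G $ Suc n) * ((2 * real n + 1) * (2 * real n + 2))"
        by (intro mult_left_mono) auto
      then show ?thesis using step[of n] by linarith
    qed
    moreover have "(\<Sum>n<3. ?G $ n * z ^ n) = A"
    proof -
      have "{..<3::nat} = {0, 1, 2}" by auto
      then show ?thesis using G1 G2 by (simp add: A_def)
    qed
    ultimately show ?thesis
      using eval_fps_tail_bound[of ?G z "1 / 6" 3] conv z by (simp add: g_def)
  qed
  then have gA: "norm (g z - A) \<le> c * \<kappa> / 25" using G3 by simp

  have "norm (g' z - B) \<le> 3 * norm (?G $ 3) / (1 - 1 / 6)"
  proof -
    have "norm (fps_deriv ?G $ Suc n) \<le> 1 / 6 * norm (fps_deriv ?G $ n)" for n
    proof -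
      have "6 * (real n + 2) * norm (?G $ Suc (Suc n))
        \<le> (real n + 1) * (norm (?G $ Suc (Suc n)) * ((2 * real (Suc n) + 1) * (2 * real (Suc n) + 2)))"
      proof -
        have "6 * (real n + 2) \<le> (real n + 1) * ((2 * real (Suc n) + 1) * (2 * real (Suc n) + 2))"
          by (simp add: algebra_simps)
        from mult_right_mono[OF this, of "norm (?G $ Suc (Suc n))"] show ?thesis
          by (simp add: mult_ac)
      qed
      also have "\<dots> \<le> (real n + 1) * norm (?G $ Suc n)"
        by (intro mult_left_mono step) auto
      finally show ?thesis by (simp add: norm_mult add_ac del: of_nat_Suc) (simp add: algebra_simps)
    qed
    moreover have "(\<Sum>n<2. fps_deriv ?G $ n * z ^ n) = B"
    proof -
      have "{..<2::nat} = {0, 1}" by auto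
      then show ?thesis using G1 G2 by (simp add: B_def numeral_2_eq_2[symmetric])
    qed
    moreover have "norm (fps_deriv ?G $ 2) = 3 * norm (?G $ 3)" by (simp add: norm_mult)
    ultimately show ?thesis
      using eval_fps_tail_bound[of "fps_deriv ?G" z "1 / 6" 2] conv' z by (simp add: g'_def)
  qed
  then have "norm (g' z - B) \<le> 3 * (c * \<kappa>) / 25" using G3 by simp
  moreover have "norm (z * (g' z - B)) \<le> 1 * norm (g' z - B)"
    using z by (subst norm_mult, intro mult_right_mono) auto
  ultimately have gB: "norm (z * (g' z - B)) \<le> 3 * (c * \<kappa>) / 25" by linarith

  have z2: "2 * x\<^sup>2 - 1 \<le> Re (z\<^sup>2)"
  proof -
    have "x\<^sup>2 + (Im z)\<^sup>2 \<le> 1"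
      using z by (metis cmod_power2 less_imp_le norm_ge_zero power_le_one x_def)
    then show ?thesis by (simp add: x_def power2_eq_square)
  qed
  have ck: "0 < c * \<kappa>" using c \<kappa> by simp
  have A: "1 - c * x + c * \<kappa> * (2 * x\<^sup>2 - 1) \<le> Re A"
    using mult_left_mono[OF z2, of "c * \<kappa>"] ck by (simp add: A_def x_def)
  have B: "norm (z * B) \<le> c * (1 - 2 * \<kappa> * x + 2 * \<kappa>\<^sup>2)"
  proof -
    \<comment> \<open>The tangent bound \<open>sqrt (1 + t) \<le> 1 + t/2\<close> replaces the modulus by an expression linear in \<open>x\<close>.\<close>
    have "norm (1 - of_real (2 * \<kappa>) * z) \<le> 1 - 2 * \<kappa> * x + 2 * \<kappa>\<^sup>2"
    proof (rule power2_le_imp_le)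
      have "(norm (1 - of_real (2 * \<kappa>) * z))\<^sup>2 = 1 - 4 * \<kappa> * x + 4 * \<kappa>\<^sup>2 * (norm z)\<^sup>2"
        unfolding cmod_power2 by (simp add: x_def power2_eq_square algebra_simps)
      also have "\<dots> \<le> 1 - 4 * \<kappa> * x + 4 * \<kappa>\<^sup>2 * 1"
        using z by (intro add_left_mono mult_left_mono) (auto simp: power_le_one)
      also have "\<dots> \<le> (1 - 2 * \<kappa> * x + 2 * \<kappa>\<^sup>2)\<^sup>2"
      proof -
        have "(1 - 2 * \<kappa> * x + 2 * \<kappa>\<^sup>2)\<^sup>2 =
            1 - 4 * \<kappa> * x + 4 * \<kappa>\<^sup>2 + (2 * \<kappa>\<^sup>2 - 2 * \<kappa> * x)\<^sup>2"
          by (simp add: power2_eq_square algebra_simps)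
        then show ?thesis by simp
      qed
      finally show "(norm (1 - of_real (2 * \<kappa>) * z))\<^sup>2 \<le> (1 - 2 * \<kappa> * x + 2 * \<kappa>\<^sup>2)\<^sup>2" .
      have "2 * \<kappa> * x \<le> 2 * \<kappa> * 1" using \<kappa> x by (intro mult_left_mono) auto
      then show "0 \<le> 1 - 2 * \<kappa> * x + 2 * \<kappa>\<^sup>2" using \<kappa> zero_le_power2[of \<kappa>] by linarith
    qed
    then have "c * norm (1 - of_real (2 * \<kappa>) * z) \<le> c * (1 - 2 * \<kappa> * x + 2 * \<kappa>\<^sup>2)"
      using c by (intro mult_left_mono) auto
    moreover have "norm B = c * norm (1 - of_real (2 * \<kappa>) * z)"
    proof -
      have "B = of_real (- c) * (1 - of_real (2 * \<kappa>) * z)" by (simp add: B_def algebra_simps)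
      then show ?thesis using c by (simp add: norm_mult)
    qed
    moreover have "norm (z * B) \<le> 1 * norm B"
      using z by (subst norm_mult, intro mult_right_mono) auto
    ultimately show ?thesis by linarith
  qed

  show "norm (z * g' z) < norm (g z)"
  proof -
    \<comment> \<open>\<open>29/25 = 1 + 1/25 + 3/25\<close> collects the error terms of \<open>gA\<close> and \<open>gB\<close>. The quadratic is
      negative for \<open>x \<ge> 1/2\<close>, and at most 2 everywhere.\<close>
    have "\<kappa> * (29 / 25 + 2 * \<kappa> - 2 * x - 2 * x\<^sup>2) < 1 - x"
    proof (cases "x \<ge> 1 / 2")
      case True
      have "1 / 2 * (1 / 2) \<le> x * x" using True by (intro mult_mono) auto
      then have "29 / 25 + 2 * \<kappa> - 2 * x - 2 * x\<^sup>2 \<le> 0" using True \<kappa> by (simp add: power2_eq_square)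
      then have "\<kappa> * (29 / 25 + 2 * \<kappa> - 2 * x - 2 * x\<^sup>2) \<le> 0" using \<kappa> by (intro mult_nonneg_nonpos) auto
      then show ?thesis using x by linarith
    next
      case False
      have "0 \<le> (2 * x + 1)\<^sup>2" by simp
      then have "29 / 25 + 2 * \<kappa> - 2 * x - 2 * x\<^sup>2 \<le> 2" using \<kappa> by (simp add: power2_eq_square algebra_simps)
      then have "\<kappa> * (29 / 25 + 2 * \<kappa> - 2 * x - 2 * x\<^sup>2) \<le> \<kappa> * 2" using \<kappa> by (intro mult_left_mono) auto
      then show ?thesis using \<kappa> False by linarith
    qed
    then have "c * (\<kappa> * (29 / 25 + 2 * \<kappa> - 2 * x - 2 * x\<^sup>2)) < c * (1 - x)"
      using c by (intro mult_strict_left_mono)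
    then have "c * (1 - 2 * \<kappa> * x + 2 * \<kappa>\<^sup>2) + 3 * (c * \<kappa>) / 25
        < 1 - c * x + c * \<kappa> * (2 * x\<^sup>2 - 1) - c * \<kappa> / 25"
      using c by (simp add: algebra_simps power2_eq_square)
    moreover have "norm (z * g' z) \<le> norm (z * B) + norm (z * (g' z - B))"
      by (metis add_diff_cancel_left' diff_add_cancel norm_triangle_ineq ring_distribs(1) add.commute)
    moreover have "Re A \<le> norm (g z) + norm (g z - A)"
      using complex_Re_le_cmod[of A] norm_triangle_sub[of A "g z"] by (simp add: norm_minus_commute)
    ultimately show ?thesis using A B gA gB by linarith
  qed

  show "0 < Re (g z + z * g' z)"
  proof -
    \<comment> \<open>Here \<open>79/25 = 3 + 1/25 + 3/25\<close>, and the quadratic is negative for \<open>x \<ge> 4/5\<close>.\<close>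
    have "\<kappa> * (79 / 25 - 6 * x\<^sup>2) < 2 - 2 * x"
    proof (cases "x \<ge> 4 / 5")
      case True
      have "4 / 5 * (4 / 5) \<le> x * x" using True by (intro mult_mono) auto
      then have "\<kappa> * (79 / 25 - 6 * x\<^sup>2) \<le> 0"
        using \<kappa> by (intro mult_nonneg_nonpos) (auto simp: power2_eq_square)
      then show ?thesis using x by linarith
    next
      case False
      have "79 / 25 - 6 * x\<^sup>2 \<le> 4" using zero_le_power2[of x] by linarith
      then have "\<kappa> * (79 / 25 - 6 * x\<^sup>2) \<le> \<kappa> * 4" using \<kappa> by (intro mult_left_mono) auto
      then show ?thesis using \<kappa> False by linarith
    qed
    then have "c * (\<kappa> * (79 / 25 - 6 * x\<^sup>2)) < c * (2 - 2 * x)"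
      using c by (intro mult_strict_left_mono)
    then have "4 * (c * \<kappa>) / 25 < 1 - 2 * c * x + 3 * (c * \<kappa>) * (2 * x\<^sup>2 - 1)"
      using c by (simp add: algebra_simps)
    moreover have "1 - 2 * c * x + 3 * (c * \<kappa>) * (2 * x\<^sup>2 - 1) \<le> Re (A + z * B)"
    proof -
      have "A + z * B = 1 - of_real (2 * c) * z + of_real (3 * (c * \<kappa>)) * z\<^sup>2"
        by (simp add: A_def B_def algebra_simps power2_eq_square)
      then have "Re (A + z * B) = 1 - 2 * c * x + 3 * (c * \<kappa>) * Re (z\<^sup>2)"
        by (simp add: x_def)
      then show ?thesis using mult_left_mono[OF z2, of "3 * (c * \<kappa>)"] ck by simp
    qed
    moreover have "Re (A + z * B) - norm (g z - A) - norm (z * (g' z - B)) \<le> Re (g z + z * g' z)"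
      using abs_Re_le_cmod[of "g z - A"] abs_Re_le_cmod[of "z * (g' z - B)"]
      by (simp add: right_diff_distrib)
    ultimately show ?thesis using gA gB by linarith
  qed
qed

lemma lommel_l_eq_eval_fps_X:
  assumes "-1 < \<mu>" "\<mu> \<noteq> 0"
  shows "lommel_l \<mu> = eval_fps (fps_X * lommel_fps \<mu>)"
  by (rule ext) (simp add: lommel_l_eq_eval_fps[OF assms] eval_fps_X_mult fps_conv_radius_lommel[OF assms])

text \<open>
  By \<open>|z g'| < |g|\<close> the quantity \<open>z l' / l = 1 + z g' / g\<close> lies in the disk of radius 1 around 1.
\<close>

lemma starlike_lommel_l:
  assumes "-1 < \<mu>" "\<mu> \<noteq> 0"
  shows "starlike_fun (lommel_l \<mu>)"
proof -
  let ?f = "lommel_l \<mu>"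
  define g where "g = eval_fps (lommel_fps \<mu>)"
  define g' where "g' = eval_fps (fps_deriv (lommel_fps \<mu>))"
  have f: "?f = (\<lambda>z. z * g z)" by (rule ext) (simp add: lommel_l_eq_eval_fps assms g_def)
  have dg: "(g has_field_derivative g' z) (at z)" for z
    unfolding g_def g'_def using fps_conv_radius_lommel[OF assms]
    by (intro has_field_derivative_eval_fps) simp
  have df: "(?f has_field_derivative g z + z * g' z) (at z)" for z
    unfolding f by (rule derivative_eq_intros dg refl)+ simp
  have df': "deriv ?f z = g z + z * g' z" for z using df by (rule DERIV_imp_deriv)
  note bounds = lommel_fps_deriv_bounds[OF assms, folded g_def g'_def]
  have holo: "?f holomorphic_on ball 0 1"
    using df by (meson holomorphic_onI field_differentiable_def field_differentiable_at_within)
  have inj: "inj_on ?f (ball 0 1)"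
    by (rule inj_on_if_Re_deriv_pos[OF holo]) (use bounds(2) in \<open>simp_all add: df' del: plus_complex.sel\<close>)
  have f0: "?f 0 = 0" by (simp add: f)
  have "0 < Re (z * deriv ?f z / ?f z)" if z: "z \<in> ball 0 1" "z \<noteq> 0" for z
  proof -
    have lt: "norm (z * g' z) < norm (g z)" using bounds z by simp
    then have gz: "g z \<noteq> 0" by auto
    have "norm (z * g' z / g z) < 1" using lt gz by (simp add: norm_divide)
    then have "\<bar>Re (z * g' z / g z)\<bar> < 1" using abs_Re_le_cmod le_less_trans by blast
    moreover have "z * deriv ?f z / ?f z = 1 + z * g' z / g z"
      using gz z by (simp add: df' fun_cong[OF f] field_simps)
    ultimately show ?thesis by simp
  qed
  then show ?thesis
    using starlike_wrt_image_ball[OF holo inj f0] holo inj f0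
    by (simp add: starlike_fun_def univalent_on_disk_def)
qed

text \<open>
  The coefficients \<open>d n\<close> of the derivative of order \<open>k + 1\<close> satisfy
  \<open>d (n + 1) / d n = - (m + 2) / ((n + 1) P)\<close> with \<open>m = n + k\<close> and
  \<open>P = (\<mu> + 2 m + 2) (\<mu> + 2 m + 3)\<close>. For \<open>m \<ge> 1\<close> the modulus is at most \<open>1/4\<close>, the value that
  \<open>n = 0\<close>, \<open>k = 1\<close> gives as \<open>\<mu> \<longrightarrow> -1\<close>.
\<close>

lemma lommel_l_derivs_close_to_convex:
  assumes "-1 < \<mu>" "\<mu> \<noteq> 0" and k: "k \<ge> 1"
  shows "close_to_convex_fun ((deriv ^^ k) (lommel_l \<mu>))"
proof -
  define F where "F = fps_X * lommel_fps \<mu>"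
  have conv: "fps_conv_radius F = \<infinity>"
    using fps_conv_radius_mult[of fps_X "lommel_fps \<mu>"] fps_conv_radius_lommel[OF assms(1,2)]
    by (simp add: F_def)
  \<comment> \<open>The factor \<open>z\<close> of \<open>l\<close> shifts the index: \<open>F $ (n + 1) = lommel_fps \<mu> $ n\<close>.\<close>
  define d where "d = (\<lambda>n. fps_deriv ((fps_deriv ^^ k) F) $ n)"
  have d: "d n = fact (n + Suc k) / fact n * lommel_fps \<mu> $ (n + k)" for n
    using fps_nth_deriv_funpow[of "Suc k" F n] by (simp add: d_def F_def del: fact_Suc)
  have "norm (d (Suc n)) \<le> 1 / 4 * norm (d n)" for n
  proof -
    define m where "m = real n + real k"
    define P where "P = (\<mu> + 2 * m + 2) * (\<mu> + 2 * m + 3)"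
    have P: "(2 * m + 1) * (2 * m + 2) \<le> P"
      unfolding P_def m_def using assms by (intro mult_mono) auto
    then have P0: "0 < P" by (rule less_le_trans[rotated]) (simp add: m_def)
    have "d (Suc n) = d n * - of_real ((m + 2) / ((real n + 1) * P))"
    proof -
      have "fact (Suc n + Suc k) = (of_real (m + 2) * fact (n + Suc k) :: complex)"
        by (simp add: m_def algebra_simps)
      moreover have "fact (Suc n) = (of_real (real n + 1) * fact n :: complex)"
        by (simp add: algebra_simps)
      moreover have "lommel_fps \<mu> $ (Suc n + k) = - lommel_fps \<mu> $ (n + k) / of_real P"
        using lommel_fps_Suc[of \<mu> "n + k"] by (simp add: P_def m_def)
      ultimately show ?thesis unfolding d by (simp del: fact_Suc of_real_add add: mult_ac)
    qed
    then have "norm (d (Suc n)) = norm (d n) * ((m + 2) / ((real n + 1) * P))"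
      using P0 by (simp only: norm_mult norm_minus_cancel norm_of_real) (simp add: m_def)
    moreover have "(m + 2) / ((real n + 1) * P) \<le> 1 / 4"
    proof -
      have "m \<ge> 1" using k by (simp add: m_def)
      then have "4 * (m + 2) \<le> (2 * m + 1) * (2 * m + 2)"
        by (sos)
      also have "\<dots> \<le> 1 * P" using P by simp
      also have "\<dots> \<le> (real n + 1) * P" using P0 by (intro mult_right_mono) auto
      finally show ?thesis using P0 by (simp add: divide_le_eq)
    qed
    ultimately show ?thesis
      using mult_left_mono[of "(m + 2) / ((real n + 1) * P)" "1 / 4" "norm (d n)"] by simp
  qed
  moreover have "(fps_deriv ^^ k) F $ 1 \<noteq> 0"
    using lommel_fps_nonzero[of \<mu> k] assms
    by (simp add: fps_nth_deriv_funpow F_def del: fact_Suc)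
  ultimately have "close_to_convex_fun (eval_fps ((fps_deriv ^^ k) F))"
    by (intro eval_fps_close_to_convex[of _ "1/4"])
      (simp_all add: fps_conv_radius_deriv_funpow_inf[OF conv] d_def)
  then show ?thesis
    using deriv_funpow_eval_fps[OF conv, of k] lommel_l_eq_eval_fps_X[OF assms(1,2)]
    by (simp add: F_def)
qed

theorem theorem3:
  fixes \<mu> :: real
  assumes "\<mu> \<in> {-1<..<1}" and "\<mu> \<noteq> 0"
  shows "starlike_fun (lommel_l \<mu>) \<and>
         (\<forall>k\<ge>1. close_to_convex_fun ((deriv ^^ k) (lommel_l \<mu>)))"
  using starlike_lommel_l[of \<mu>] lommel_l_derivs_close_to_convex[of \<mu>] assms by simp

end
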